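(* Let $\mu\in\mathcal P_2(\mathbb{R})$ and let $U$ be a nonempty open set in $(\mathcal P_2(\mathbb{R}),\mathcal W_2)$. Then there exists $\nu\in U$ such that $\mu,\nu$ are order unrelated, i.e. neither $\mu\le_{\mathrm{st}}\nu$ nor $\nu\le_{\mathrm{st}}\mu$. In particular, any order interval in $\mathcal P_2(\mathbb{R})$ has no interior point.
   Context: $\mathcal P_2(\mathbb{R})$ is the set of Borel probability measures on $\mathbb{R}$ with finite second moment, with the 2-Wasserstein metric $\mathcal W_2$. Stochastic order: $\mu\le_{\mathrm{st}}\nu$ iff $\int f\,\mathrm d\mu\le\int f\,\mathrm d\nu$ for all bounded increasing (non-decreasing) $f:\mathbb{R}\to\mathbb{R}$. Order intervals are the sets $[\mu_1,\mu_2]=\{\rho\in\mathcal P_2(\mathbb{R}):\mu_1\le_{\mathrm{st}}\rho\le_{\mathrm{st}}\mu_2\}$ for $\mu_1\le_{\mathrm{st}}\mu_2$ in $\mathcal P_2(\mathbb{R})$. *)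

theory Defs
  imports "HOL-Probability.Probability"
begin

definition P2 :: "real measure set" where
  "P2 = {\<mu>. real_distribution \<mu> \<and> integrable \<mu> (\<lambda>x. x\<^sup>2)}"

definition couplings :: "real measure \<Rightarrow> real measure \<Rightarrow> (real \<times> real) measure set" where
  "couplings \<mu> \<nu> = {\<pi>. prob_space \<pi> \<and> sets \<pi> = sets (borel \<Otimes>\<^sub>M borel) \<and>
     distr \<pi> borel fst = \<mu> \<and> distr \<pi> borel snd = \<nu>}"

text \<open>On \<^const>\<open>P2\<close> the infimum is finite (the product coupling has finite cost), so
  \<^const>\<open>enn2real\<close> loses nothing there.\<close>

definition W2 :: "real measure \<Rightarrow> real measure \<Rightarrow> real" where
  "W2 \<mu> \<nu> = sqrt (enn2real
     (INF \<pi>\<in>couplings \<mu> \<nu>. \<integral>\<^sup>+ z. ennreal ((fst z - snd z)\<^sup>2) \<partial>\<pi>))"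

text \<open>The topology of the metric space (\<^const>\<open>P2\<close>, \<^const>\<open>W2\<close>): the right-hand side is what
  \<open>Metric_space.mtopology\<close> unfolds to. Written out, it does not depend on a proof of the metric
  axioms.\<close>

definition W2_topology :: "real measure topology" where
  "W2_topology = topology (\<lambda>U. U \<subseteq> P2 \<and>
     (\<forall>\<mu>\<in>U. \<exists>r>0. {\<nu> \<in> P2. W2 \<mu> \<nu> < r} \<subseteq> U))"

lemma openin_W2_topology:
  "openin W2_topology U \<longleftrightarrow>
     U \<subseteq> P2 \<and> (\<forall>\<mu>\<in>U. \<exists>r>0. {\<nu> \<in> P2. W2 \<mu> \<nu> < r} \<subseteq> U)"
proof -
  let ?op = "\<lambda>U. U \<subseteq> P2 \<and> (\<forall>\<mu>\<in>U. \<exists>r>0. {\<nu> \<in> P2. W2 \<mu> \<nu> < r} \<subseteq> U)"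
  have "istopology ?op"
    unfolding istopology_def
  proof (intro conjI allI impI)
    fix S T assume S: "?op S" and T: "?op T"
    show "S \<inter> T \<subseteq> P2" using S by blast
    show "\<forall>\<mu>\<in>S \<inter> T. \<exists>r>0. {\<nu> \<in> P2. W2 \<mu> \<nu> < r} \<subseteq> S \<inter> T"
    proof
      fix \<mu> assume "\<mu> \<in> S \<inter> T"
      then obtain r s where "r > 0" "{\<nu> \<in> P2. W2 \<mu> \<nu> < r} \<subseteq> S"
        and "s > 0" "{\<nu> \<in> P2. W2 \<mu> \<nu> < s} \<subseteq> T"
        using S T by blast
      then show "\<exists>r>0. {\<nu> \<in> P2. W2 \<mu> \<nu> < r} \<subseteq> S \<inter> T"
        by (intro exI[of _ "min r s"]) auto
    qed
  next
    fix \<K> assume K: "\<forall>K\<in>\<K>. ?op K"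
    show "\<Union>\<K> \<subseteq> P2" using K by blast
    show "\<forall>\<mu>\<in>\<Union>\<K>. \<exists>r>0. {\<nu> \<in> P2. W2 \<mu> \<nu> < r} \<subseteq> \<Union>\<K>"
      using K by (meson Sup_upper UnionE order_trans)
  qed
  then show ?thesis
    by (simp add: W2_topology_def)
qed

lemma topspace_W2_topology: "topspace W2_topology = P2"
proof -
  have "openin W2_topology P2"
    by (auto simp: openin_W2_topology intro: exI[of _ "1::real"])
  then show ?thesis
    by (auto simp: topspace_def openin_W2_topology)
qed

text \<open>A monotone real function is Borel measurable, so for Borel probability measures both
  integrals below are genuine.\<close>

definition stoch_le :: "real measure \<Rightarrow> real measure \<Rightarrow> bool" (infix "\<le>\<^sub>s\<^sub>t" 50) where
  "\<mu> \<le>\<^sub>s\<^sub>t \<nu> \<longleftrightarrow>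
     (\<forall>f :: real \<Rightarrow> real. mono f \<longrightarrow> bounded (range f) \<longrightarrow> (\<integral>x. f x \<partial>\<mu>) \<le> (\<integral>x. f x \<partial>\<nu>))"

definition order_interval :: "real measure \<Rightarrow> real measure \<Rightarrow> real measure set" where
  "order_interval \<mu>\<^sub>1 \<mu>\<^sub>2 = {\<rho> \<in> P2. \<mu>\<^sub>1 \<le>\<^sub>s\<^sub>t \<rho> \<and> \<rho> \<le>\<^sub>s\<^sub>t \<mu>\<^sub>2}"

end

theory Submission
  imports Defs "HOL-Real_Asymp.Real_Asymp"
begin

text \<open>Mass escaping to infinity can be visible in the tails while being cheap in \<^const>\<open>W2\<close>:
  sending a fraction \<open>1 / n\<close> of a measure to each of the points \<open>\<plusminus>t\<close> with \<open>t\<^sup>2 = c n\<close> costs about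
  \<open>2 c\<close>, and gives both tails beyond \<open>t\<close> mass at least \<open>1 / n\<close>, whereas a finite second
  moment forces tails of size \<open>o(1 / n)\<close> there.\<close>

text \<open>Indicators of upward closed rays are bounded increasing test functions, and integrating
  them gives measures of upper tails. Closed lower tails are handled as complements of the open rays
  \<open>{a<..}\<close>.\<close>

lemma stoch_le_tails:
  assumes "real_distribution \<mu>" "real_distribution \<nu>" "\<mu> \<le>\<^sub>s\<^sub>t \<nu>"
  shows "measure \<mu> {a..} \<le> measure \<nu> {a..}" "measure \<nu> {..a} \<le> measure \<mu> {..a}"
proof -
  interpret \<mu>: real_distribution \<mu> by fact
  interpret \<nu>: real_distribution \<nu> by fact
  have up: "measure \<mu> S \<le> measure \<nu> S" if "mono (indicator S :: real \<Rightarrow> real)" "S \<in> sets borel" for S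
  proof -
    have "bounded (range (indicator S :: real \<Rightarrow> real))"
      by (rule boundedI[of _ 1]) (auto simp: indicator_def)
    then show ?thesis
      using assms(3)[unfolded stoch_le_def, rule_format, OF that(1)] that(2) by simp
  qed
  show "measure \<mu> {a..} \<le> measure \<nu> {a..}"
    by (rule up) (auto simp: mono_def indicator_def)
  have "measure \<mu> {a<..} \<le> measure \<nu> {a<..}"
    by (rule up) (auto simp: mono_def indicator_def)
  moreover have "{a<..} = UNIV - {..a}" by auto
  ultimately show "measure \<nu> {..a} \<le> measure \<mu> {..a}"
    using \<mu>.prob_compl[of "{..a}"] \<nu>.prob_compl[of "{..a}"] by simp
qed

text \<open>Markov's inequality would only bound this sequence, and the decay comes from dominated
  convergence. For fixed \<open>x\<close>, \<open>n\<close> times the indicator vanishes once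
  \<open>n\<close> exceeds \<open>x\<^sup>2 / c\<close>, and it never exceeds
  \<open>x\<^sup>2 / c\<close>, which is integrable.\<close>

lemma P2_tail_small:
  assumes "\<mu> \<in> P2" "c > 0"
  shows "(\<lambda>n. real n * measure \<mu> {x. c * real n \<le> x\<^sup>2}) \<longlonglongrightarrow> 0"
proof -
  interpret real_distribution \<mu> using assms by (simp add: P2_def)
  have int: "integrable \<mu> (\<lambda>x. x\<^sup>2)" using assms by (simp add: P2_def)
  let ?A = "\<lambda>n. {x::real. c * real n \<le> x\<^sup>2}"
  have "(\<lambda>n. \<integral>x. real n * indicator (?A n) x \<partial>\<mu>) \<longlonglongrightarrow> (\<integral>x. 0 \<partial>\<mu>)"
  proof (rule integral_dominated_convergence[where w = "\<lambda>x. x\<^sup>2 / c"])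
    show "AE x in \<mu>. (\<lambda>n. real n * indicator (?A n) x) \<longlonglongrightarrow> 0"
    proof (rule AE_I2, rule tendsto_eventually)
      fix x :: real
      obtain N where "x\<^sup>2 / c < real N" using reals_Archimedean2 by blast
      then have "\<forall>n\<ge>N. x\<^sup>2 / c < real n" by (meson less_le_trans of_nat_mono)
      then have "\<forall>n\<ge>N. real n * indicator (?A n) x = 0"
        using \<open>c > 0\<close> by (auto simp: indicator_def field_simps)
      then show "\<forall>\<^sub>F n in sequentially. real n * indicator (?A n) x = 0"
        unfolding eventually_sequentially by blast
    qed
    show "AE x in \<mu>. norm (real n * indicator (?A n) x) \<le> x\<^sup>2 / c" for n
      using \<open>c > 0\<close> by (intro AE_I2) (auto simp: indicator_def field_simps)
  qed (use int in auto)
  then show ?thesis by simp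
qed

text \<open>Turns the cost of a single explicit coupling into a distance bound, so optimal couplings
  never have to be discussed.\<close>

lemma W2_less:
  assumes "\<pi> \<in> couplings \<mu> \<nu>" "(\<integral>\<^sup>+ z. ennreal ((fst z - snd z)\<^sup>2) \<partial>\<pi>) < ennreal (r\<^sup>2)" "r > 0"
  shows "W2 \<mu> \<nu> < r"
proof -
  have "(INF \<pi>\<in>couplings \<mu> \<nu>. \<integral>\<^sup>+ z. ennreal ((fst z - snd z)\<^sup>2) \<partial>\<pi>) < ennreal (r\<^sup>2)" (is "?I < _")
    using assms(1,2) by (meson INF_lower le_less_trans)
  then have "enn2real ?I < r\<^sup>2"
    using \<open>r > 0\<close> by (cases ?I) (auto simp: ennreal_less_iff)
  then show ?thesis
    unfolding W2_def using \<open>r > 0\<close> real_sqrt_less_mono by fastforce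
qed

text \<open>Draw a point from \<open>\<rho>\<close> and an independent label uniform on
  \<open>{..<n}\<close>. Label 0 sends the point to \<open>t\<close>, label 1 sends it to
  \<open>-t\<close>, and every other label leaves it in place. The law of the image is
  \<open>\<nu>\<close>, and the joint law of point and image is \<open>\<pi>\<close>.\<close>

lemma P2_move_mass_to_tails:
  fixes t :: real and n :: nat
  assumes "\<rho> \<in> P2" "n \<ge> 2"
  obtains \<nu> \<pi> where "\<nu> \<in> P2" "\<pi> \<in> couplings \<rho> \<nu>"
    "measure \<nu> {t..} \<ge> 1 / n" "measure \<nu> {..-t} \<ge> 1 / n"
    "(\<integral>\<^sup>+ z. ennreal ((fst z - snd z)\<^sup>2) \<partial>\<pi>) \<le> ennreal (4 * ((\<integral>x. x\<^sup>2 \<partial>\<rho>) + t\<^sup>2) / n)"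
proof -
  interpret \<rho>: real_distribution \<rho> using assms by (simp add: P2_def)
  have int: "integrable \<rho> (\<lambda>x. x\<^sup>2)" using assms by (simp add: P2_def)
  define Q where "Q = measure_pmf (pmf_of_set {..<n})"
  interpret Q: prob_space Q unfolding Q_def by (rule prob_space_measure_pmf)
  interpret P: pair_prob_space \<rho> Q ..
  define g where "g = (\<lambda>z :: real \<times> nat. if snd z = 0 then t else if snd z = 1 then - t else fst z)"
  have sQ[measurable_cong]: "sets Q = sets (count_space UNIV)" by (simp add: Q_def)
  have g[measurable]: "g \<in> borel_measurable (\<rho> \<Otimes>\<^sub>M Q)"
    unfolding g_def by measurable
  have ne: "{..<n} \<noteq> {}" using assms(2) by (simp add: lessThan_empty_iff)
  define \<nu> where "\<nu> = distr (\<rho> \<Otimes>\<^sub>M Q) borel g"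
  define \<pi> where "\<pi> = distr (\<rho> \<Otimes>\<^sub>M Q) (borel \<Otimes>\<^sub>M borel) (\<lambda>z. (fst z, g z))"
  have fst: "distr (\<rho> \<Otimes>\<^sub>M Q) borel fst = \<rho>"
    using Q.distr_pair_fst[of \<rho>] by (simp cong: distr_cong)
  have \<nu>: "\<nu> \<in> P2"
  proof -
    have "integrable (\<rho> \<Otimes>\<^sub>M Q) (\<lambda>z. (fst z)\<^sup>2)"
      using int by (subst (asm) fst[symmetric], subst (asm) integrable_distr_eq) auto
    \<comment> \<open>The value of \<open>g\<close> is \<open>t\<close>, \<open>-t\<close> or the
      original point, so this sum dominates its square in every case.\<close>
    then have "integrable (\<rho> \<Otimes>\<^sub>M Q) (\<lambda>z. (fst z)\<^sup>2 + t\<^sup>2)" by simp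
    then have "integrable (\<rho> \<Otimes>\<^sub>M Q) (\<lambda>z. (g z)\<^sup>2)"
      by (rule Bochner_Integration.integrable_bound) (auto simp: g_def)
    then show ?thesis unfolding P2_def \<nu>_def
      by (auto simp: integrable_distr_eq intro!: P.real_distribution_distr)
  qed
  have \<pi>: "\<pi> \<in> couplings \<rho> \<nu>"
    unfolding couplings_def \<pi>_def \<nu>_def
    by (auto simp: distr_distr o_def fst intro!: P.prob_space_distr)
  \<comment> \<open>The event that the label equals \<open>k\<close> has probability
    \<open>1 / n\<close>, and \<open>g\<close> maps all of it into \<open>S\<close>.\<close>
  have tail: "1 / n \<le> measure \<nu> S"
    if "k < n" "S \<in> sets borel" "\<And>x. g (x, k) \<in> S" for k S
  proof -
    have "emeasure (\<rho> \<Otimes>\<^sub>M Q) (UNIV \<times> {k}) = emeasure \<rho> UNIV * emeasure Q {k}"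
      by (rule Q.emeasure_pair_measure_Times) (auto simp: sQ)
    also have "\<dots> = ennreal (1 / n)"
      using \<open>k < n\<close> ne \<rho>.emeasure_space_1 by (simp add: Q_def emeasure_pmf_of_set)
    finally have "1 / n = measure (\<rho> \<Otimes>\<^sub>M Q) (UNIV \<times> {k})"
      by (simp add: measure_def)
    also have "\<dots> \<le> measure (\<rho> \<Otimes>\<^sub>M Q) (g -` S \<inter> space (\<rho> \<Otimes>\<^sub>M Q))"
      using that measurable_sets[OF g, of S]
      by (intro P.finite_measure_mono) (auto simp: space_pair_measure Q_def)
    also have "\<dots> = measure \<nu> S" unfolding \<nu>_def using that by (simp add: measure_distr)
    finally show ?thesis .
  qed
  have tails: "1 / n \<le> measure \<nu> {t..}" "1 / n \<le> measure \<nu> {..-t}"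
    using assms(2) tail[of 0 "{t..}"] tail[of 1 "{..-t}"] by (simp_all add: g_def)
  have "(\<integral>\<^sup>+ z. ennreal ((fst z - snd z)\<^sup>2) \<partial>\<pi>) \<le> ennreal (4 * ((\<integral>x. x\<^sup>2 \<partial>\<rho>) + t\<^sup>2) / n)"
  proof -
    \<comment> \<open>The two squares on the left add up to
      \<open>2 * (x\<^sup>2 + t\<^sup>2)\<close>, so each is bounded by that sum because the other
      is nonnegative.\<close>
    have sq: "(x - t)\<^sup>2 \<le> 2 * (x\<^sup>2 + t\<^sup>2)" "(x + t)\<^sup>2 \<le> 2 * (x\<^sup>2 + t\<^sup>2)" for x
      using zero_le_power2[of "x + t"] zero_le_power2[of "x - t"]
      by (simp_all add: power2_eq_square algebra_simps)
    have "(\<integral>\<^sup>+ z. ennreal ((fst z - snd z)\<^sup>2) \<partial>\<pi>) = (\<integral>\<^sup>+ z. ennreal ((fst z - g z)\<^sup>2) \<partial>(\<rho> \<Otimes>\<^sub>M Q))"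
      unfolding \<pi>_def by (subst nn_integral_distr) auto
    \<comment> \<open>Only labels 0 and 1 move a point. By independence the cost then factors into
      the second-moment bound times the probability \<open>2 / n\<close> of these labels.\<close>
    also have "\<dots> \<le> (\<integral>\<^sup>+ z. ennreal (2 * ((fst z)\<^sup>2 + t\<^sup>2)) * indicator {..<2} (snd z) \<partial>(\<rho> \<Otimes>\<^sub>M Q))"
      by (intro nn_integral_mono)
        (auto simp: g_def indicator_def simp del: ennreal_plus distrib_left_numeral
          intro!: ennreal_leI sq)
    also have "\<dots> = (\<integral>\<^sup>+ x. \<integral>\<^sup>+ k. ennreal (2 * (x\<^sup>2 + t\<^sup>2)) * indicator {..<2} k \<partial>Q \<partial>\<rho>)"
    proof -
      have [measurable]: "(\<lambda>z. indicator {..<2} (snd z) :: ennreal) \<in> borel_measurable (\<rho> \<Otimes>\<^sub>M Q)"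
        by (rule measurable_compose[OF measurable_snd]) (simp add: Q_def)
      show ?thesis by (subst Q.nn_integral_fst[symmetric]) auto
    qed
    also have "\<dots> = (\<integral>\<^sup>+ x. ennreal (2 * (x\<^sup>2 + t\<^sup>2)) * emeasure Q {..<2} \<partial>\<rho>)"
      by (simp add: nn_integral_cmult_indicator sQ)
    also have "emeasure Q {..<2} = ennreal (2 / n)"
    proof -
      have "{..<n} \<inter> {..<2} = {..<2::nat}" using assms(2) by auto
      then show ?thesis using ne by (simp add: Q_def emeasure_pmf_of_set)
    qed
    also have "(\<integral>\<^sup>+ x. ennreal (2 * (x\<^sup>2 + t\<^sup>2)) * ennreal (2 / n) \<partial>\<rho>)
        = (\<integral>\<^sup>+ x. ennreal (2 * (x\<^sup>2 + t\<^sup>2) * (2 / n)) \<partial>\<rho>)"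
      by (subst ennreal_mult) auto
    also have "\<dots> = ennreal (\<integral>x. 2 * (x\<^sup>2 + t\<^sup>2) * (2 / n) \<partial>\<rho>)"
      using int by (intro nn_integral_eq_integral) auto
    also have "(\<integral>x. 2 * (x\<^sup>2 + t\<^sup>2) * (2 / n) \<partial>\<rho>) = 4 * ((\<integral>x. x\<^sup>2 \<partial>\<rho>) + t\<^sup>2) / n"
      using int \<rho>.prob_space by simp
    finally show ?thesis .
  qed
  then show ?thesis using that[OF \<nu> \<pi> tails] by blast
qed

lemma unrelated_in_W2_ball:
  assumes "\<mu> \<in> P2" "\<rho> \<in> P2" "r > 0"
  shows "\<exists>\<nu>\<in>P2. W2 \<rho> \<nu> < r \<and> \<not> \<mu> \<le>\<^sub>s\<^sub>t \<nu> \<and> \<not> \<nu> \<le>\<^sub>s\<^sub>t \<mu>"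
proof -
  interpret real_distribution \<mu> using assms by (simp add: P2_def)
  \<comment> \<open>With \<open>t\<^sup>2 = c * n\<close> the cost bound becomes
    \<open>4 * m / n + 4 * c\<close>. The second term is half of \<open>r\<^sup>2\<close>, and the
    first falls below the other half for large \<open>n\<close>.\<close>
  define c where "c = r\<^sup>2 / 8"
  define m where "m = (\<integral>x. x\<^sup>2 \<partial>\<rho>)"
  have c: "c > 0" using assms by (simp add: c_def)
  have "\<forall>\<^sub>F n in sequentially. real n * measure \<mu> {x. c * real n \<le> x\<^sup>2} < 1"
    using P2_tail_small[OF assms(1) c] by (rule order_tendstoD) simp
  moreover have "\<forall>\<^sub>F n in sequentially. 4 * m / real n < 4 * c"
    using c by real_asymp
  moreover have "\<forall>\<^sub>F n::nat in sequentially. n \<ge> 2" by (rule eventually_ge_at_top)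
  ultimately have "\<forall>\<^sub>F n in sequentially. real n * measure \<mu> {x. c * real n \<le> x\<^sup>2} < 1 \<and>
      4 * m / real n < 4 * c \<and> n \<ge> 2"
    by eventually_elim auto
  then obtain n :: nat where n: "real n * measure \<mu> {x. c * real n \<le> x\<^sup>2} < 1"
      "4 * m / real n < 4 * c" "n \<ge> 2"
    using eventually_happens'[OF sequentially_bot] by blast
  \<comment> \<open>This makes the set in the tail estimate for \<open>\<mu>\<close> exactly the
    points at distance at least \<open>t\<close> from 0.\<close>
  define t where "t = sqrt (c * real n)"
  have t: "t \<ge> 0" "t\<^sup>2 = c * real n" using c by (simp_all add: t_def)
  obtain \<nu> \<pi> where \<nu>: "\<nu> \<in> P2" "\<pi> \<in> couplings \<rho> \<nu>"
    "measure \<nu> {t..} \<ge> 1 / n" "measure \<nu> {..-t} \<ge> 1 / n"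
    "(\<integral>\<^sup>+ z. ennreal ((fst z - snd z)\<^sup>2) \<partial>\<pi>) \<le> ennreal (4 * (m + t\<^sup>2) / n)"
    using P2_move_mass_to_tails[OF assms(2) n(3), of t, folded m_def] by this
  have "4 * (m + t\<^sup>2) / n = 4 * m / n + 4 * c"
    using n(3) by (simp add: t field_simps)
  also have "\<dots> < r\<^sup>2" using n(2) by (simp add: c_def)
  finally have "ennreal (4 * (m + t\<^sup>2) / n) < ennreal (r\<^sup>2)"
    using assms(3) by (simp add: ennreal_lessI)
  then have near: "W2 \<rho> \<nu> < r"
    by (intro W2_less[OF \<nu>(2)] le_less_trans[OF \<nu>(5)] assms(3))
  have small: "measure \<mu> S < 1 / n" if "S \<subseteq> {x. t\<^sup>2 \<le> x\<^sup>2}" for S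
  proof -
    have "measure \<mu> S \<le> measure \<mu> {x. c * real n \<le> x\<^sup>2}"
      using that by (intro finite_measure_mono) (auto simp: t)
    also have "\<dots> < 1 / n" using n(1,3) by (simp add: field_simps)
    finally show ?thesis .
  qed
  have "measure \<mu> {t..} < 1 / n" "measure \<mu> {..-t} < 1 / n"
    using t(1) by (auto intro!: small power_mono abs_le_square_iff[THEN iffD1])
  \<comment> \<open>Each tail refutes one direction: the lower tail of \<open>\<nu>\<close> is too
    heavy for \<open>\<nu>\<close> to lie above \<open>\<mu>\<close>, and its upper tail is too
    heavy for \<open>\<nu>\<close> to lie below.\<close>
  with \<nu> assms(1) have "\<not> \<mu> \<le>\<^sub>s\<^sub>t \<nu>" "\<not> \<nu> \<le>\<^sub>s\<^sub>t \<mu>"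
    using stoch_le_tails[of \<mu> \<nu> "-t"] stoch_le_tails[of \<nu> \<mu> t] by (auto simp: P2_def)
  with near show ?thesis using \<nu>(1) by blast
qed

theorem propositionA1:
  shows "(\<forall>\<mu>\<in>P2. \<forall>U. openin W2_topology U \<and> U \<noteq> {} \<longrightarrow>
            (\<exists>\<nu>\<in>U. \<not> \<mu> \<le>\<^sub>s\<^sub>t \<nu> \<and> \<not> \<nu> \<le>\<^sub>s\<^sub>t \<mu>)) \<and>
         (\<forall>\<mu>\<^sub>1\<in>P2. \<forall>\<mu>\<^sub>2\<in>P2. \<mu>\<^sub>1 \<le>\<^sub>s\<^sub>t \<mu>\<^sub>2 \<longrightarrow>
            W2_topology interior_of (order_interval \<mu>\<^sub>1 \<mu>\<^sub>2) = {})"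
proof -
  have unrelated: "\<exists>\<nu>\<in>U. \<not> \<mu> \<le>\<^sub>s\<^sub>t \<nu> \<and> \<not> \<nu> \<le>\<^sub>s\<^sub>t \<mu>"
    if "\<mu> \<in> P2" "openin W2_topology U" "U \<noteq> {}" for \<mu> U
  proof -
    note U = that
    obtain \<rho> r where "\<rho> \<in> P2" "r > 0" "{\<nu> \<in> P2. W2 \<rho> \<nu> < r} \<subseteq> U"
      using U(2,3) unfolding openin_W2_topology by blast
    then show ?thesis using unrelated_in_W2_ball[OF U(1)] by blast
  qed
  \<comment> \<open>The interior is open, so if nonempty it would contain a measure unrelated to the
    lower endpoint, whereas every member of the interval lies above that endpoint.\<close>
  moreover have "W2_topology interior_of (order_interval \<mu>\<^sub>1 \<mu>\<^sub>2) = {}" if "\<mu>\<^sub>1 \<in> P2" for \<mu>\<^sub>1 \<mu>\<^sub>2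
    using unrelated[OF that openin_interior_of] interior_of_subset[of W2_topology]
    unfolding order_interval_def by blast
  ultimately show ?thesis by blast
qed

end
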